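(* For every integer $n\ge1$, the expectation of the number $X_n$ of swaps of Quicksort for a list of length $n$ under Variant II is $$E[X_n]=(n+1)H_1(n)-2n.$$
   Context: $H_k(n)=\sum_{i=1}^n \frac1{i^k}$. Variant II of Quicksort, applied to a uniformly random ordering of $n$ distinct elements: the position $i\in\{1,\dots,n\}$ of the pivot is chosen uniformly at random; each element before the pivot that is larger than the pivot is moved to the end of the list (one swap), and each element after the pivot that is smaller than the pivot is inserted before the pivot (one swap); then the procedure is applied recursively to the two sublists. $X_n$ is the total number of swaps. Formally, let $Q(n,k,i,t)$ be the probability generating function of the number of entries that are either before position $i$ and larger than $k$, or after position $i$ and smaller than $k$, in a uniformly random permutation of $\{1,\dots,n\}$ conditioned on its $i$-th entry being $k$. The probability generating function $P_n(t)=\sum_{m\ge0}P(X_n=m)t^m$ is determined by $P_0(t)=P_1(t)=1$ and $P_n(t)=\frac1{n^2}\sum_{k=1}^n\sum_{i=1}^n P_{k-1}(t)P_{n-k}(t)Q(n,k,i,t)$ for $n\ge2$. *)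

theory Defs
  imports "HOL-Probability.Probability"
begin

definition gen_harmonic :: "nat \<Rightarrow> nat \<Rightarrow> real" where
  "gen_harmonic k n = (\<Sum>i=1..n. 1 / real i ^ k)"

(* List positions are counted from 0, so the pivot of xs is xs ! i with i < length xs.
   Lists are meant to be distinct: the two filters only keep elements different from the pivot. *)

definition swaps_at :: "'a::linorder list \<Rightarrow> nat \<Rightarrow> nat" where
  "swaps_at xs i =
     length (filter (\<lambda>x. x > xs ! i) (take i xs)) +
     length (filter (\<lambda>x. x < xs ! i) (drop (Suc i) xs))"

definition left_part :: "'a::linorder list \<Rightarrow> nat \<Rightarrow> 'a list" where
  "left_part xs i =
     filter (\<lambda>x. x < xs ! i) (take i xs) @ filter (\<lambda>x. x < xs ! i) (drop (Suc i) xs)"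

definition right_part :: "'a::linorder list \<Rightarrow> nat \<Rightarrow> 'a list" where
  "right_part xs i =
     filter (\<lambda>x. x > xs ! i) (drop (Suc i) xs) @ filter (\<lambda>x. x > xs ! i) (take i xs)"

lemma length_part_less:
  assumes "i < length xs"
  shows "length (left_part xs i) < length xs" "length (right_part xs i) < length xs"
proof -
  have "length (filter P (take i xs)) \<le> i" for P
    by (rule order_trans[OF length_filter_le]) (use assms in auto)
  moreover have "length (filter P (drop (Suc i) xs)) \<le> length xs - Suc i" for P
    by (rule order_trans[OF length_filter_le]) auto
  ultimately have "length (filter P (take i xs)) + length (filter P (drop (Suc i) xs)) < length xs" for P
    using assms by (smt (verit) Suc_leI add_diff_inverse_nat add_le_mono add_Suc not_less le_imp_less_Suc less_imp_le_nat)
  thus "length (left_part xs i) < length xs" "length (right_part xs i) < length xs"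
    by (auto simp: left_part_def right_part_def add.commute)
qed

(* Distribution of the total number of swaps on the fixed input list xs; the randomness is that
   of the pivot positions. *)

function quicksort_swaps :: "'a::linorder list \<Rightarrow> nat pmf" where
  "quicksort_swaps xs =
     (if length xs \<le> 1 then return_pmf 0
      else do {
        i \<leftarrow> pmf_of_set {..<length xs};
        a \<leftarrow> quicksort_swaps (left_part xs i);
        b \<leftarrow> quicksort_swaps (right_part xs i);
        return_pmf (swaps_at xs i + a + b)
      })"
  by auto
termination
proof (relation "Wellfounded.measure length")
  fix xs :: "'a list" and i
  assume "\<not> length xs \<le> 1" "i \<in> set_pmf (pmf_of_set {..<length xs})"
  hence "i < length xs" by (subst (asm) set_pmf_of_set) (auto simp: lessThan_empty_iff)
  thus "(left_part xs i, xs) \<in> Wellfounded.measure length" "(right_part xs i, xs) \<in> Wellfounded.measure length"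
    by (auto intro: length_part_less)
qed auto

declare quicksort_swaps.simps [simp del]

(* The distribution of X_n, whose generating function is P_n; num_swaps_pgf_base and
   num_swaps_pgf_rec below confirm that it satisfies the recurrence that determines P_n. *)

definition num_swaps :: "nat \<Rightarrow> nat pmf" where
  "num_swaps n = pmf_of_set (permutations_of_set {1..n}) \<bind> quicksort_swaps"

definition pgf :: "nat pmf \<Rightarrow> real \<Rightarrow> real" where
  "pgf p t = measure_pmf.expectation p (\<lambda>m. t ^ m)"

(* Its generating function is Q(n,k,i,t): the number of entries before position i that exceed k or
   after position i that are below k, in a random permutation conditioned on entry i being k.
   Here positions range over 1..n. *)

definition swaps_pmf :: "nat \<Rightarrow> nat \<Rightarrow> nat \<Rightarrow> nat pmf" where
  "swaps_pmf n k i =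
     map_pmf (\<lambda>xs. swaps_at xs (i - 1))
       (cond_pmf (pmf_of_set (permutations_of_set {1..n})) {xs. xs ! (i - 1) = k})"

lemma finite_quicksort_swaps [simp]: "finite (set_pmf (quicksort_swaps xs))"
proof (induction xs rule: quicksort_swaps.induct)
  case (1 xs)
  show ?case
  proof (cases "length xs \<le> 1")
    case True
    thus ?thesis by (subst quicksort_swaps.simps) simp
  next
    case False
    hence "{..<length xs} \<noteq> {}" by (auto simp: lessThan_empty_iff)
    moreover from this have "set_pmf (pmf_of_set {..<length xs}) = {..<length xs}"
      by (intro set_pmf_of_set) auto
    ultimately show ?thesis
      using 1 False by (subst quicksort_swaps.simps) (auto simp: set_bind_pmf)
  qed
qed

lemma pgf_finite: "finite (set_pmf p) \<Longrightarrow> pgf p t = (\<Sum>m\<in>set_pmf p. pmf p m * t ^ m)"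
  unfolding pgf_def by (subst integral_measure_pmf[of "set_pmf p"]) auto

lemma pgf_sum_indep:
  assumes "finite (set_pmf p)" "finite (set_pmf q)"
  shows "pgf (do {a \<leftarrow> p; b \<leftarrow> q; return_pmf (c + a + b)}) t = t ^ c * pgf p t * pgf q t"
proof -
  have "pgf (do {b \<leftarrow> q; return_pmf (c + a + b)}) t = t ^ (c + a) * pgf q t" for a
    unfolding pgf_def by (subst pmf_expectation_bind[of "set_pmf q"])
      (use assms in \<open>auto simp: pgf_finite[unfolded pgf_def] sum_distrib_left power_add mult_ac\<close>)
  hence "measure_pmf.expectation (do {b \<leftarrow> q; return_pmf (c + a + b)}) (\<lambda>m. t ^ m) =
           t ^ (c + a) * pgf q t" for a by (simp add: pgf_def)
  thus ?thesis using assms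
    by (subst pgf_def, subst pmf_expectation_bind[of "set_pmf p"])
      (auto simp: set_bind_pmf pgf_finite[of p] sum_distrib_left sum_distrib_right power_add mult_ac)
qed

lemma pgf_quicksort_swaps:
  assumes "length xs \<ge> 2"
  shows "pgf (quicksort_swaps xs) t =
    (\<Sum>i<length xs. t ^ swaps_at xs i * pgf (quicksort_swaps (left_part xs i)) t *
                     pgf (quicksort_swaps (right_part xs i)) t) / length xs"
proof -
  have ne: "{..<length xs} \<noteq> {}" using assms by (cases xs) (auto simp: lessThan_empty_iff)
  have "pgf (quicksort_swaps xs) t = measure_pmf.expectation (pmf_of_set {..<length xs} \<bind> (\<lambda>i. do {
        a \<leftarrow> quicksort_swaps (left_part xs i);
        b \<leftarrow> quicksort_swaps (right_part xs i);
        return_pmf (swaps_at xs i + a + b)})) (\<lambda>m. t ^ m)"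
    using assms by (subst quicksort_swaps.simps) (simp add: pgf_def)
  also have "\<dots> = (\<Sum>i<length xs. pgf (do {
        a \<leftarrow> quicksort_swaps (left_part xs i);
        b \<leftarrow> quicksort_swaps (right_part xs i);
        return_pmf (swaps_at xs i + a + b)}) t /\<^sub>R real (card {..<length xs}))"
    unfolding pgf_def by (rule pmf_expectation_bind_pmf_of_set) (use ne in \<open>auto simp: set_bind_pmf\<close>)
  finally show ?thesis
    by (simp add: pgf_sum_indep sum_distrib_left divide_inverse_commute)
qed

lemma pgf_num_swaps:
  "pgf (num_swaps n) t =
     (\<Sum>xs\<in>permutations_of_set {1..n}. pgf (quicksort_swaps xs) t) / fact n"
  unfolding pgf_def num_swaps_def
  by (subst pmf_expectation_bind_pmf_of_set) (auto simp: sum_distrib_left divide_inverse_commute)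

lemma parts_map:
  assumes "i < length xs"
    and "\<And>x. x \<in> set xs \<Longrightarrow> f x < f (xs ! i) \<longleftrightarrow> x < xs ! i"
    and "\<And>x. x \<in> set xs \<Longrightarrow> f (xs ! i) < f x \<longleftrightarrow> xs ! i < x"
  shows "swaps_at (map f xs) i = swaps_at xs i"
    and "left_part (map f xs) i = map f (left_part xs i)"
    and "right_part (map f xs) i = map f (right_part xs i)"
proof -
  have s: "set (take i xs) \<subseteq> set xs" "set (drop (Suc i) xs) \<subseteq> set xs"
    by (auto dest: in_set_takeD in_set_dropD)
  have *: "filter (\<lambda>x. f x < f (xs ! i)) (take i xs) = filter (\<lambda>x. x < xs ! i) (take i xs)"
       "filter (\<lambda>x. f x < f (xs ! i)) (drop (Suc i) xs) = filter (\<lambda>x. x < xs ! i) (drop (Suc i) xs)"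
       "filter (\<lambda>x. f (xs ! i) < f x) (take i xs) = filter (\<lambda>x. xs ! i < x) (take i xs)"
       "filter (\<lambda>x. f (xs ! i) < f x) (drop (Suc i) xs) = filter (\<lambda>x. xs ! i < x) (drop (Suc i) xs)"
    using assms s by (auto intro!: filter_cong)
  show "swaps_at (map f xs) i = swaps_at xs i"
    and "left_part (map f xs) i = map f (left_part xs i)"
    and "right_part (map f xs) i = map f (right_part xs i)"
    using assms(1) by (simp_all add: swaps_at_def left_part_def right_part_def take_map drop_map
        filter_map o_def *)
qed

lemma set_parts:
  "set (left_part xs i) \<subseteq> set xs" "set (right_part xs i) \<subseteq> set xs"
  by (auto simp: left_part_def right_part_def dest: in_set_takeD in_set_dropD)

lemma quicksort_swaps_map:
  fixes f :: "'a::linorder \<Rightarrow> 'b::linorder"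
  assumes "strict_mono_on (set xs) f"
  shows "quicksort_swaps (map f xs) = quicksort_swaps xs"
  using assms
proof (induction xs rule: quicksort_swaps.induct)
  case (1 xs)
  show ?case
  proof (cases "length xs \<le> 1")
    case True
    thus ?thesis by (subst (1 2) quicksort_swaps.simps) simp
  next
    case False
    hence ne: "{..<length xs} \<noteq> {}" by (auto simp: lessThan_empty_iff)
    have S: "set_pmf (pmf_of_set {..<length xs}) = {..<length xs}"
      using ne by (intro set_pmf_of_set) auto
    have less: "f x < f y \<longleftrightarrow> x < y" if "x \<in> set xs" "y \<in> set xs" for x y
      using 1(3) that by (simp add: strict_mono_on_less)
    have IH: "quicksort_swaps (map f (left_part xs i)) = quicksort_swaps (left_part xs i)"
             "quicksort_swaps (map f (right_part xs i)) = quicksort_swaps (right_part xs i)"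
      if "i < length xs" for i
      using 1(1)[OF False] 1(2)[OF False] that S set_parts[of xs i]
        set_pmf_not_empty[of "quicksort_swaps (left_part xs i)"]
        monotone_on_subset[OF 1(3)]
      by blast+
    show ?thesis using False
      by (subst (1 2) quicksort_swaps.simps)
         (auto intro!: bind_pmf_cong simp: S parts_map less IH)
  qed
qed

lemma sum_permutes_eq_sum_permutations_of_set:
  fixes h :: "'a list \<Rightarrow> 'b::comm_monoid_add"
  assumes "finite A" "ys \<in> permutations_of_set A"
  shows "(\<Sum>\<sigma> | \<sigma> permutes A. h (map \<sigma> ys)) = (\<Sum>zs\<in>permutations_of_set A. h zs)"
proof (rule sum.reindex_bij_betw)
  have ys: "set ys = A" using assms(2) by (auto dest: permutations_of_setD)
  have inj: "inj_on (\<lambda>\<sigma>. map \<sigma> ys) {\<sigma>. \<sigma> permutes A}"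
  proof (rule inj_onI)
    fix \<sigma> \<tau> assume "\<sigma> \<in> {\<sigma>. \<sigma> permutes A}" "\<tau> \<in> {\<sigma>. \<sigma> permutes A}" "map \<sigma> ys = map \<tau> ys"
    thus "\<sigma> = \<tau>" using ys by (intro ext) (metis map_eq_conv mem_Collect_eq permutes_not_in)
  qed
  have "(\<lambda>\<sigma>. map \<sigma> ys) ` {\<sigma>. \<sigma> permutes A} = permutations_of_set A"
  proof (rule card_subset_eq)
    show "(\<lambda>\<sigma>. map \<sigma> ys) ` {\<sigma>. \<sigma> permutes A} \<subseteq> permutations_of_set A"
      using permutations_of_set_image_permutes assms(2) by blast
  qed (use assms inj in \<open>auto simp: card_image card_permutations\<close>)
  with inj show "bij_betw (\<lambda>\<sigma>. map \<sigma> ys) {\<sigma>. \<sigma> permutes A} (permutations_of_set A)"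
    by (simp add: bij_betw_def)
qed

lemma parts_permutations:
  assumes "xs \<in> permutations_of_set {1..n}" "i < n"
  shows "left_part xs i \<in> permutations_of_set {1..xs ! i - 1}"
    and "right_part xs i \<in> permutations_of_set {xs ! i + 1..n}"
proof -
  have xs: "set xs = {1..n}" "distinct xs" "length xs = n"
    using assms length_finite_permutations_of_set[OF assms(1)] by (auto dest: permutations_of_setD)
  have eq: "xs = take i xs @ xs ! i # drop (Suc i) xs"
    using assms xs by (simp add: id_take_nth_drop)
  have st: "set xs = set (take i xs) \<union> {xs ! i} \<union> set (drop (Suc i) xs)"
    by (subst eq) auto
  have pv: "xs ! i \<in> {1..n}" using xs assms(2) nth_mem by fastforce
  have split: "x \<in> set (take i xs) \<or> x \<in> set (drop (Suc i) xs)" if "x \<in> {1..n}" "x \<noteq> xs ! i" for x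
    using that st xs(1) by blast
  have sub: "x \<in> {1..n}" if "x \<in> set (take i xs) \<or> x \<in> set (drop (Suc i) xs)" for x
    using that st xs(1) by blast
  have d: "set (take i xs) \<inter> set (drop (Suc i) xs) = {}"
    using xs by (auto simp: set_take_disj_set_drop_if_distinct)
  show "left_part xs i \<in> permutations_of_set {1..xs ! i - 1}"
  proof (intro permutations_of_setI equalityI subsetI)
    fix x assume x: "x \<in> {1..xs ! i - 1}"
    hence "x \<in> {1..n}" "x \<noteq> xs ! i" "x < xs ! i" using pv by auto
    thus "x \<in> set (left_part xs i)" using split[of x] by (auto simp: left_part_def)
  qed (use d xs sub in \<open>force simp: left_part_def\<close>)+
  show "right_part xs i \<in> permutations_of_set {xs ! i + 1..n}"
  proof (intro permutations_of_setI equalityI subsetI)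
    fix x assume x: "x \<in> {xs ! i + 1..n}"
    hence "x \<in> {1..n}" "x \<noteq> xs ! i" "x > xs ! i" using pv by auto
    thus "x \<in> set (right_part xs i)" using split[of x] by (auto simp: right_part_def)
  qed (use d xs sub in \<open>force simp: right_part_def\<close>)+
qed

lemma sum_pivot_fixed:
  assumes "i < n" "k \<in> {1..n}"
  defines "S \<equiv> {xs \<in> permutations_of_set {1..n}. xs ! i = k}"
  shows "(\<Sum>xs\<in>S. t ^ swaps_at xs i * pgf (quicksort_swaps (left_part xs i)) t *
            pgf (quicksort_swaps (right_part xs i)) t) =
         (\<Sum>xs\<in>S. t ^ swaps_at xs i) * pgf (num_swaps (k - 1)) t * pgf (num_swaps (n - k)) t"
    (is "sum ?F S = _")
proof -
  let ?G = "\<lambda>xs :: nat list. pgf (quicksort_swaps xs) t"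
  let ?L = "{\<sigma>. \<sigma> permutes {1..k - 1}}" and ?R = "{\<tau>. \<tau> permutes {k + 1..n}}"
  have len: "length xs = n" "set xs = {1..n}" "distinct xs" if "xs \<in> S" for xs
    using that length_finite_permutations_of_set[of xs "{1..n}"]
    by (auto simp: S_def dest: permutations_of_setD)
  have finS: "finite S" unfolding S_def by simp
  have cL: "real (card ?L) = fact (k - 1)" and cR: "real (card ?R) = fact (n - k)"
    by (subst card_permutations[OF refl]; simp)+
  have F: "sum ?F S = (\<Sum>xs\<in>S. t ^ swaps_at xs i * ?G (map \<sigma> (left_part xs i)) *
                                  ?G (map \<tau> (right_part xs i)))"
    if s: "\<sigma> \<in> ?L" and r: "\<tau> \<in> ?R" for \<sigma> \<tau>
  proof -
    define f where "f = \<sigma> \<circ> \<tau>"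
    have sp: "\<sigma> permutes {1..k - 1}" and tp: "\<tau> permutes {k + 1..n}" using s r by auto
    have f: "f permutes {1..n}" unfolding f_def
      using sp tp assms(2) by (intro permutes_compose) (auto elim!: permutes_subset)
    have s0: "\<sigma> x = x" if "x \<ge> k \<or> x = 0" for x
      using permutes_not_in[OF sp, of x] that assms(2) by auto
    have t0: "\<tau> x = x" if "x \<le> k" for x
      using permutes_not_in[OF tp, of x] that by auto
    have s1: "\<sigma> x < k" if "x < k" for x
      using permutes_in_image[OF sp, of x] that s0[of x] by (cases "x = 0") auto
    have t1: "\<tau> x > k" if "x > k" for x
      using permutes_in_image[OF tp, of x] permutes_not_in[OF tp, of x] that
      by (cases "x \<le> n") auto
    have fk: "f k = k" using s0 t0 by (simp add: f_def)
    have fl: "f x = \<sigma> x" if "x < k" for x using that t0 by (simp add: f_def)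
    have fr: "f x = \<tau> x" if "x > k" for x using that t1[of x] s0 by (simp add: f_def)
    have c1: "f x < f k \<longleftrightarrow> x < k" for x
      by (metis fk fl fr linorder_less_linear order_less_asym s1 t1)
    have c2: "f k < f x \<longleftrightarrow> k < x" for x
      by (metis fk fl fr linorder_less_linear order_less_asym s1 t1)
    have bij: "bij_betw (map f) S S"
    proof -
      have "inj_on (map f) S" using permutes_inj[OF f] by (auto intro: inj_on_subset)
      moreover have "map f ` S \<subseteq> S"
      proof (rule image_subsetI)
        fix xs assume xs: "xs \<in> S"
        have "map f xs \<in> permutations_of_set {1..n}"
          using permutations_of_set_image_permutes[OF f] xs unfolding S_def by blast
        moreover have "map f xs ! i = k" using xs len[OF xs] fk assms(1) by (simp add: S_def)
        ultimately show "map f xs \<in> S" by (simp add: S_def)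
      qed
      ultimately show ?thesis using finS by (simp add: bij_betw_def endo_inj_surj)
    qed
    have "sum ?F S = (\<Sum>xs\<in>S. ?F (map f xs))"
      by (rule sum.reindex_bij_betw[OF bij, symmetric])
    also have "\<dots> = (\<Sum>xs\<in>S. t ^ swaps_at xs i * ?G (map \<sigma> (left_part xs i)) *
                                  ?G (map \<tau> (right_part xs i)))"
    proof (rule sum.cong[OF refl])
      fix xs assume xs: "xs \<in> S"
      hence k: "xs ! i = k" by (simp add: S_def)
      have "map f (left_part xs i) = map \<sigma> (left_part xs i)"
        by (auto simp: left_part_def k fl)
      moreover have "map f (right_part xs i) = map \<tau> (right_part xs i)"
        by (auto simp: right_part_def k fr)
      ultimately show "?F (map f xs) = t ^ swaps_at xs i * ?G (map \<sigma> (left_part xs i)) *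
                                  ?G (map \<tau> (right_part xs i))"
        using len[OF xs] assms(1) c1 c2 by (simp add: parts_map k del: map_eq_conv)
    qed
    finally show ?thesis .
  qed
  have sumL: "(\<Sum>\<sigma>\<in>?L. ?G (map \<sigma> (left_part xs i))) = fact (k - 1) * pgf (num_swaps (k - 1)) t"
    if "xs \<in> S" for xs
    using parts_permutations(1)[of xs n i] that assms(1)
    by (subst sum_permutes_eq_sum_permutations_of_set) (auto simp: S_def pgf_num_swaps)
  have sumR: "(\<Sum>\<tau>\<in>?R. ?G (map \<tau> (right_part xs i))) = fact (n - k) * pgf (num_swaps (n - k)) t"
    if "xs \<in> S" for xs
  proof -
    have im: "(\<lambda>x. x + k) ` {1..n - k} = {k + 1..n}"
      using assms(2) by (simp add: image_add_atLeastAtMost')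
    have "permutations_of_set {k + 1..n} = map (\<lambda>x. x + k) ` permutations_of_set {1..n - k}"
      unfolding im[symmetric] by (rule permutations_of_set_image_inj) auto
    moreover have "inj_on (map (\<lambda>x. x + k)) A" for A
      by (rule inj_on_subset[of _ UNIV]) auto
    moreover have "?G (map (\<lambda>x. x + k) ys) = ?G ys" for ys
      by (subst quicksort_swaps_map) (auto simp: strict_mono_on_def)
    ultimately have "(\<Sum>zs\<in>permutations_of_set {k + 1..n}. ?G zs) =
                       fact (n - k) * pgf (num_swaps (n - k)) t"
      by (simp add: sum.reindex pgf_num_swaps)
    thus ?thesis
      using parts_permutations(2)[of xs n i] that assms(1)
      by (subst sum_permutes_eq_sum_permutations_of_set) (auto simp: S_def)
  qed
  have "fact (k - 1) * fact (n - k) * sum ?F S = (\<Sum>\<sigma>\<in>?L. \<Sum>\<tau>\<in>?R. sum ?F S)"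
    using cL cR by simp
  also have "\<dots> = (\<Sum>\<sigma>\<in>?L. \<Sum>\<tau>\<in>?R. \<Sum>xs\<in>S. t ^ swaps_at xs i *
      ?G (map \<sigma> (left_part xs i)) * ?G (map \<tau> (right_part xs i)))"
    by (intro sum.cong refl F)
  also have "\<dots> = (\<Sum>\<sigma>\<in>?L. \<Sum>xs\<in>S. \<Sum>\<tau>\<in>?R. t ^ swaps_at xs i *
      ?G (map \<sigma> (left_part xs i)) * ?G (map \<tau> (right_part xs i)))"
    by (intro sum.cong refl sum.swap)
  also have "\<dots> = (\<Sum>xs\<in>S. \<Sum>\<sigma>\<in>?L. \<Sum>\<tau>\<in>?R. t ^ swaps_at xs i *
      ?G (map \<sigma> (left_part xs i)) * ?G (map \<tau> (right_part xs i)))"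
    by (rule sum.swap)
  also have "\<dots> = (\<Sum>xs\<in>S. t ^ swaps_at xs i * ((\<Sum>\<sigma>\<in>?L. ?G (map \<sigma> (left_part xs i))) *
      (\<Sum>\<tau>\<in>?R. ?G (map \<tau> (right_part xs i)))))"
    by (simp only: sum_product) (simp only: sum_distrib_left mult.assoc)
  also have "\<dots> = (\<Sum>xs\<in>S. t ^ swaps_at xs i * ((fact (k - 1) * pgf (num_swaps (k - 1)) t) *
      (fact (n - k) * pgf (num_swaps (n - k)) t)))"
    by (intro sum.cong refl) (simp only: sumL sumR)
  also have "\<dots> = fact (k - 1) * fact (n - k) * ((\<Sum>xs\<in>S. t ^ swaps_at xs i) *
      pgf (num_swaps (k - 1)) t * pgf (num_swaps (n - k)) t)"
    by (simp add: sum_distrib_right sum_distrib_left mult_ac)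
  finally show ?thesis by simp
qed

lemma card_pivot_fixed:
  assumes "i < n" "k \<in> {1..n}"
  shows "real (card {xs \<in> permutations_of_set {1..n}. xs ! i = k}) = fact n / real n"
proof -
  let ?S = "\<lambda>k. {xs \<in> permutations_of_set {1..n}. xs ! i = k}"
  have le: "card (?S a) \<le> card (?S b)" if ab: "a \<in> {1..n}" "b \<in> {1..n}" for a b
  proof (rule card_inj_on_le[of "map (Transposition.transpose a b)"])
    have p: "Transposition.transpose a b permutes {1..n}" using ab by (rule permutes_swap_id)
    show "inj_on (map (Transposition.transpose a b)) (?S a)"
      using permutes_inj[OF p] by (meson inj_mapI inj_on_subset subset_UNIV)
    show "map (Transposition.transpose a b) ` ?S a \<subseteq> ?S b"
    proof (rule image_subsetI)
      fix xs assume xs: "xs \<in> ?S a"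
      hence "map (Transposition.transpose a b) xs \<in> permutations_of_set {1..n}"
        using permutations_of_set_image_permutes[OF p] by blast
      thus "map (Transposition.transpose a b) xs \<in> ?S b"
        using xs assms(1) length_finite_permutations_of_set[of xs "{1..n}"] by simp
    qed
  qed simp
  have eq: "card (?S a) = card (?S k)" if "a \<in> {1..n}" for a
    using le that assms(2) by (intro antisym) auto
  have "permutations_of_set {1..n} = (\<Union>a\<in>{1..n}. ?S a)"
  proof (intro equalityI subsetI)
    fix xs assume xs: "xs \<in> permutations_of_set {1..n}"
    hence "xs ! i \<in> set xs" 
      using assms(1) length_finite_permutations_of_set[OF xs] by (intro nth_mem) simp
    thus "xs \<in> (\<Union>a\<in>{1..n}. ?S a)" using xs by (auto dest: permutations_of_setD)
  qed auto
  hence "fact n = card (\<Union>a\<in>{1..n}. ?S a)"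
    using card_permutations_of_set[of "{1..n}"] by simp
  also have "\<dots> = (\<Sum>a\<in>{1..n}. card (?S a))"
    by (rule card_UN_disjoint) auto
  also have "\<dots> = n * card (?S k)" using eq by simp
  finally have "real n * real (card (?S k)) = fact n"
    by (metis of_nat_fact of_nat_mult)
  thus ?thesis using assms(1) by (simp add: field_simps)
qed

lemma pgf_swaps_pmf:
  assumes "i \<in> {1..n}" "k \<in> {1..n}"
  shows "pgf (swaps_pmf n k i) t =
    (\<Sum>xs | xs \<in> permutations_of_set {1..n} \<and> xs ! (i - 1) = k. t ^ swaps_at xs (i - 1)) *
      real n / fact n"
proof -
  let ?A = "permutations_of_set {1..n}" and ?B = "{xs. xs ! (i - 1) = k}"
  let ?S = "{xs \<in> permutations_of_set {1..n}. xs ! (i - 1) = k}"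
  have c: "real (card ?S) = fact n / real n" using card_pivot_fixed[of "i - 1" n k] assms by auto
  have S: "?A \<inter> ?B = ?S" by auto
  from c have "?S \<noteq> {}" using assms by (metis card.empty divide_eq_0_iff fact_nonzero of_nat_0
        of_nat_eq_0_iff atLeastAtMost_iff not_one_le_zero order_trans)
  hence ne: "set_pmf (pmf_of_set ?A) \<inter> ?B \<noteq> {}" by auto
  have m: "measure_pmf.prob (pmf_of_set ?A) ?B = 1 / real n"
    using c assms by (subst measure_pmf_of_set) (auto simp: S[unfolded One_nat_def])
  have "pgf (swaps_pmf n k i) t = (\<Sum>xs\<in>?S.
          pmf (cond_pmf (pmf_of_set ?A) ?B) xs * t ^ swaps_at xs (i - 1))"
    unfolding pgf_def swaps_pmf_def using ne
    by (simp add: integral_map_pmf, subst integral_measure_pmf[of ?S]) auto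
  also have "\<dots> = (\<Sum>xs\<in>?S. t ^ swaps_at xs (i - 1) * (real n / fact n))"
  proof (intro sum.cong refl)
    fix xs assume "xs \<in> ?S"
    hence "xs \<in> ?A" "xs \<in> ?B" by auto
    thus "pmf (cond_pmf (pmf_of_set ?A) ?B) xs * t ^ swaps_at xs (i - 1) =
            t ^ swaps_at xs (i - 1) * (real n / fact n)"
      using pmf_cond[OF ne, of xs] m by simp
  qed
  finally show ?thesis by (simp add: sum_distrib_right sum_divide_distrib)
qed

lemma num_swaps_pgf_base: "pgf (num_swaps 0) t = 1" "pgf (num_swaps 1) t = 1"
  by (simp_all add: pgf_num_swaps quicksort_swaps.simps) (simp_all add: pgf_def)

lemma num_swaps_pgf_rec:
  assumes "n \<ge> 2"
  shows "pgf (num_swaps n) t =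
    1 / real n ^ 2 * (\<Sum>k=1..n. \<Sum>i=1..n. pgf (num_swaps (k - 1)) t * pgf (num_swaps (n - k)) t *
                                   pgf (swaps_pmf n k i) t)"
proof -
  let ?A = "permutations_of_set {1..n}"
  let ?S = "\<lambda>i k. {xs \<in> permutations_of_set {1..n}. xs ! i = k}"
  let ?F = "\<lambda>i xs. t ^ swaps_at xs i * pgf (quicksort_swaps (left_part xs i)) t *
            pgf (quicksort_swaps (right_part xs i)) t"
  have "fact n * real n * pgf (num_swaps n) t = (\<Sum>xs\<in>?A. real n * pgf (quicksort_swaps xs) t)"
    by (simp only: pgf_num_swaps sum_distrib_left[symmetric]) simp
  also have "\<dots> = (\<Sum>xs\<in>?A. \<Sum>i<n. ?F i xs)"
    using assms length_finite_permutations_of_set[of _ "{1..n}"]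
    by (intro sum.cong refl) (auto simp: pgf_quicksort_swaps)
  also have "\<dots> = (\<Sum>i<n. \<Sum>xs\<in>?A. ?F i xs)" by (rule sum.swap)
  also have "\<dots> = (\<Sum>i<n. \<Sum>k=1..n. \<Sum>xs\<in>?S i k. ?F i xs)"
  proof (intro sum.cong refl)
    fix i assume i: "i \<in> {..<n}"
    have "(\<lambda>xs. xs ! i) ` ?A \<subseteq> {1..n}"
    proof (rule image_subsetI)
      fix xs assume xs: "xs \<in> ?A"
      have "xs ! i \<in> set xs" 
        using i length_finite_permutations_of_set[OF xs] by (intro nth_mem) simp
      thus "xs ! i \<in> {1..n}" using xs by (auto dest: permutations_of_setD)
    qed
    thus "(\<Sum>xs\<in>?A. ?F i xs) = (\<Sum>k=1..n. \<Sum>xs\<in>?S i k. ?F i xs)"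
      by (intro sum.group[symmetric]) auto
  qed
  also have "\<dots> = (\<Sum>i<n. \<Sum>k=1..n. (\<Sum>xs\<in>?S i k. t ^ swaps_at xs i) *
                     pgf (num_swaps (k - 1)) t * pgf (num_swaps (n - k)) t)"
    by (intro sum.cong refl sum_pivot_fixed) auto
  also have "\<dots> = (\<Sum>i=1..n. \<Sum>k=1..n. (\<Sum>xs\<in>?S (i - 1) k. t ^ swaps_at xs (i - 1)) *
                     pgf (num_swaps (k - 1)) t * pgf (num_swaps (n - k)) t)"
    by (rule sum.reindex_bij_witness[of _ "\<lambda>i. i - 1" Suc]) auto
  also have "\<dots> = (\<Sum>i=1..n. \<Sum>k=1..n. fact n / real n * (pgf (num_swaps (k - 1)) t *
                     pgf (num_swaps (n - k)) t * pgf (swaps_pmf n k i) t))"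
    using assms by (intro sum.cong refl) (simp add: pgf_swaps_pmf)
  also have "\<dots> = fact n / real n * (\<Sum>k=1..n. \<Sum>i=1..n. pgf (num_swaps (k - 1)) t *
                     pgf (num_swaps (n - k)) t * pgf (swaps_pmf n k i) t)"
    by (subst sum.swap) (simp add: sum_distrib_left)
  finally show ?thesis using assms by (simp add: field_simps power2_eq_square)
qed

end

theory Submission
  imports Defs
begin

text \<open>
  The expectation of a finitely supported distribution on the naturals is the derivative of its
  generating function at \<open>1\<close>, so the recurrence for the generating functions of
  \<open>num_swaps n\<close> can be differentiated there. Every generating function has value \<open>1\<close> at \<open>1\<close>, hence
  each summand contributes the sum of the three derivatives: the expected costs of the two
  recursive calls, and the mean number of swaps around a pivot of value \<open>k\<close> in position \<open>i\<close>.

  That mean depends on \<open>k\<close> and \<open>i\<close>, but only its sum over \<open>k\<close> matters, and this is governed by the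
  mean for a fixed position and a random permutation. The latter is \<open>(n - 1) / 2\<close> whatever the
  position: reversing the order of the values, \<open>x \<mapsto> n + 1 - x\<close>, exchanges the entries that must be
  swapped with those that may stay, so a permutation and its mirror image together need \<open>n - 1\<close>
  swaps around that position (lemma \<open>sum_swaps_at\<close>).

  The result is the recurrence \<open>n E(n) = n (n - 1) / 2 + 2 (E(0) + \<dots> + E(n - 1))\<close>
  (lemma \<open>expectation_num_swaps_rec\<close>), which the claimed closed form satisfies as well
  (lemma \<open>closed_form_rec\<close>).
\<close>

lemma pgf_1 [simp]: "pgf p 1 = 1"
  by (simp add: pgf_def)

lemma pgf_has_derivative_at_1:
  assumes "finite (set_pmf p)"
  shows "(pgf p has_real_derivative measure_pmf.expectation p real) (at 1)"
proof -
  have "pgf p = (\<lambda>t. \<Sum>m\<in>set_pmf p. pmf p m * t ^ m)"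
    using pgf_finite[OF assms] by blast
  moreover have "((\<lambda>t. \<Sum>m\<in>set_pmf p. pmf p m * t ^ m) has_real_derivative
      (\<Sum>m\<in>set_pmf p. pmf p m * real m)) (at 1)"
    by (auto intro!: derivative_eq_intros sum.cong)
  moreover have "measure_pmf.expectation p real = (\<Sum>m\<in>set_pmf p. pmf p m * real m)"
    using assms by (subst integral_measure_pmf[of "set_pmf p"]) auto
  ultimately show ?thesis by simp
qed

lemma finite_num_swaps [simp]: "finite (set_pmf (num_swaps n))"
  by (simp add: num_swaps_def set_bind_pmf)

lemma expectation_num_swaps_0: "measure_pmf.expectation (num_swaps 0) real = 0"
proof (rule DERIV_unique)
  show "(pgf (num_swaps 0) has_real_derivative measure_pmf.expectation (num_swaps 0) real) (at 1)"
    by (simp add: pgf_has_derivative_at_1)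
  have "pgf (num_swaps 0) = (\<lambda>t. 1)" using num_swaps_pgf_base(1) by blast
  thus "(pgf (num_swaps 0) has_real_derivative 0) (at 1)" by simp
qed

lemma expectation_num_swaps_1: "measure_pmf.expectation (num_swaps 1) real = 0"
proof (rule DERIV_unique)
  show "(pgf (num_swaps 1) has_real_derivative measure_pmf.expectation (num_swaps 1) real) (at 1)"
    by (simp add: pgf_has_derivative_at_1)
  have "pgf (num_swaps 1) = (\<lambda>t. 1)" using num_swaps_pgf_base(2) by blast
  thus "(pgf (num_swaps 1) has_real_derivative 0) (at 1)" by simp
qed

text \<open>
  An order-reversing map exchanges ``larger'' and ``smaller'', so each entry other than the pivot
  is counted for exactly one of the two lists.
\<close>

lemma swaps_at_add_swaps_at_reversed:
  fixes f :: "'a::linorder \<Rightarrow> 'b::linorder"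
  assumes "distinct xs" "i < length xs"
    and less: "\<And>x y. x \<in> set xs \<Longrightarrow> y \<in> set xs \<Longrightarrow> f x < f y \<longleftrightarrow> y < x"
  shows "swaps_at xs i + swaps_at (map f xs) i = length xs - 1"
proof -
  let ?p = "xs ! i"
  have sub: "set (take i xs) \<subseteq> set xs" "set (drop (Suc i) xs) \<subseteq> set xs"
    by (auto dest: in_set_takeD in_set_dropD)
  have eq: "xs = take i xs @ ?p # drop (Suc i) xs"
    using assms(2) by (simp add: id_take_nth_drop)
  have "distinct (take i xs @ ?p # drop (Suc i) xs)" using assms(1) eq by simp
  hence ne: "?p \<notin> set (take i xs)" "?p \<notin> set (drop (Suc i) xs)" by auto
  have A: "filter (\<lambda>x. f x > f ?p) (take i xs) = filter (\<lambda>x. \<not> x > ?p) (take i xs)"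
    using less[OF nth_mem[OF assms(2)]] sub ne(1) by (intro filter_cong) force+
  have B: "filter (\<lambda>x. f x < f ?p) (drop (Suc i) xs) = filter (\<lambda>x. \<not> x < ?p) (drop (Suc i) xs)"
    using less[OF _ nth_mem[OF assms(2)]] sub ne(2) by (intro filter_cong) force+
  have "swaps_at (map f xs) i = length (filter (\<lambda>x. \<not> x > ?p) (take i xs)) +
          length (filter (\<lambda>x. \<not> x < ?p) (drop (Suc i) xs))"
    using assms(2) by (simp add: swaps_at_def take_map drop_map filter_map o_def A B)
  moreover have "length (filter (\<lambda>x. x > ?p) (take i xs)) +
      length (filter (\<lambda>x. \<not> x > ?p) (take i xs)) = length (take i xs)"
    by (rule sum_length_filter_compl)
  moreover have "length (filter (\<lambda>x. x < ?p) (drop (Suc i) xs)) +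
      length (filter (\<lambda>x. \<not> x < ?p) (drop (Suc i) xs)) = length (drop (Suc i) xs)"
    by (rule sum_length_filter_compl)
  ultimately show ?thesis using assms(2) by (simp add: swaps_at_def)
qed

text \<open>
  Mirroring the values is a bijection of the permutations, so the sum equals its own mirror image,
  while both together count \<open>n - 1\<close> for each of the \<open>n!\<close> permutations.
\<close>

lemma sum_swaps_at:
  assumes "i < n"
  shows "(\<Sum>xs\<in>permutations_of_set {1..n}. real (swaps_at xs i)) = fact n * (real n - 1) / 2"
proof -
  let ?A = "permutations_of_set {1..n}"
  define r where "r = (\<lambda>x. n + 1 - x)"
  have inj: "inj_on r {1..n}" by (auto simp: r_def inj_on_def)
  have im: "r ` {1..n} = {1..n}"
    using inj by (intro endo_inj_surj) (auto simp: r_def)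
  have img: "map r ` ?A = ?A"
    using permutations_of_set_image_inj[OF inj] im by simp
  have "finite ?A" by simp
  hence "inj_on (map r) ?A" using img by (intro eq_card_imp_inj_on) auto
  hence bij: "bij_betw (map r) ?A ?A" using img by (simp add: bij_betw_def)
  have "2 * (\<Sum>xs\<in>?A. real (swaps_at xs i)) =
          (\<Sum>xs\<in>?A. real (swaps_at xs i)) + (\<Sum>xs\<in>?A. real (swaps_at (map r xs) i))"
    using sum.reindex_bij_betw[OF bij, of "\<lambda>xs. real (swaps_at xs i)"] by simp
  also have "\<dots> = (\<Sum>xs\<in>?A. real n - 1)"
  proof (subst sum.distrib[symmetric], rule sum.cong[OF refl])
    fix xs assume xs: "xs \<in> ?A"
    hence *: "set xs = {1..n}" "distinct xs" "length xs = n"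
      using length_finite_permutations_of_set[OF xs] by (auto dest: permutations_of_setD)
    have "swaps_at xs i + swaps_at (map r xs) i = length xs - 1"
      using * assms by (intro swaps_at_add_swaps_at_reversed) (auto simp: r_def)
    thus "real (swaps_at xs i) + real (swaps_at (map r xs) i) = real n - 1"
      using * assms by (simp flip: of_nat_add add: of_nat_diff)
  qed
  finally show ?thesis by simp
qed

text \<open>
  The averages over the permutations with a prescribed pivot value combine to the average over all
  permutations, because every value is equally likely to be the pivot.
\<close>

lemma sum_swaps_at_pivot_fixed:
  assumes "i < n"
  shows "(\<Sum>k=1..n. \<Sum>xs | xs \<in> permutations_of_set {1..n} \<and> xs ! i = k. real (swaps_at xs i)) =
           fact n * (real n - 1) / 2"
proof -
  have "xs ! i \<in> {1..n}" if "xs \<in> permutations_of_set {1..n}" for xs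
    using assms length_finite_permutations_of_set[OF that] nth_mem[of i xs]
      permutations_of_setD(1)[OF that] by (simp del: atLeastAtMost_iff)
  thus ?thesis
    by (subst sum_swaps_at[OF assms, symmetric], intro sum.group) auto
qed

text \<open>
  The factor \<open>n / n!\<close> is the reciprocal of the number of permutations with entry \<open>k\<close> in position
  \<open>i\<close>, so the derivative is the mean number of swaps over these permutations.
\<close>

lemma pgf_swaps_pmf_has_derivative_at_1:
  assumes "i \<in> {1..n}" "k \<in> {1..n}"
  shows "(pgf (swaps_pmf n k i) has_real_derivative
    (\<Sum>xs | xs \<in> permutations_of_set {1..n} \<and> xs ! (i - 1) = k. real (swaps_at xs (i - 1))) *
      real n / fact n) (at 1)"
proof -
  have "pgf (swaps_pmf n k i) = (\<lambda>t.
      (\<Sum>xs | xs \<in> permutations_of_set {1..n} \<and> xs ! (i - 1) = k. t ^ swaps_at xs (i - 1)) *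
        real n / fact n)"
    using pgf_swaps_pmf[OF assms] by blast
  thus ?thesis by (auto intro!: derivative_eq_intros simp del: One_nat_def)
qed

lemma expectation_num_swaps_rec:
  "real n * measure_pmf.expectation (num_swaps n) real =
     real n * (real n - 1) / 2 + 2 * (\<Sum>k<n. measure_pmf.expectation (num_swaps k) real)"
proof (cases "n \<ge> 2")
  case False
  hence "n = 0 \<or> n = 1" by auto
  thus ?thesis
    using expectation_num_swaps_0 expectation_num_swaps_1 by (auto simp: lessThan_Suc)
next
  case True
  let ?E = "\<lambda>n. measure_pmf.expectation (num_swaps n) real"
  let ?D = "\<lambda>k i. (\<Sum>xs | xs \<in> permutations_of_set {1..n} \<and> xs ! (i - 1) = k.
              real (swaps_at xs (i - 1))) * real n / fact n"
  have pgf_eq: "pgf (num_swaps n) = (\<lambda>t. 1 / real n ^ 2 * (\<Sum>k=1..n. \<Sum>i=1..n.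
      pgf (num_swaps (k - 1)) t * pgf (num_swaps (n - k)) t * pgf (swaps_pmf n k i) t))"
    using num_swaps_pgf_rec[OF True] by blast
  have "(pgf (num_swaps n) has_real_derivative
          1 / real n ^ 2 * (\<Sum>k=1..n. \<Sum>i=1..n. ?E (k - 1) + ?E (n - k) + ?D k i)) (at 1)"
    unfolding pgf_eq
  proof (intro DERIV_cmult DERIV_sum)
    fix k i assume "k \<in> {1..n}" "i \<in> {1..n}"
    from DERIV_mult[OF DERIV_mult[OF pgf_has_derivative_at_1 pgf_has_derivative_at_1]
        pgf_swaps_pmf_has_derivative_at_1[OF this(2,1)], of "num_swaps (k - 1)" "num_swaps (n - k)"]
    show "((\<lambda>t. pgf (num_swaps (k - 1)) t * pgf (num_swaps (n - k)) t * pgf (swaps_pmf n k i) t)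
            has_real_derivative ?E (k - 1) + ?E (n - k) + ?D k i) (at 1)"
      by (simp add: add.commute del: One_nat_def)
  qed
  hence "?E n = 1 / real n ^ 2 * (\<Sum>k=1..n. \<Sum>i=1..n. ?E (k - 1) + ?E (n - k) + ?D k i)"
    by (rule DERIV_unique[OF pgf_has_derivative_at_1[OF finite_num_swaps]])
  also have "(\<Sum>k=1..n. \<Sum>i=1..n. ?E (k - 1) + ?E (n - k) + ?D k i) =
      real n * (\<Sum>k=1..n. ?E (k - 1)) + real n * (\<Sum>k=1..n. ?E (n - k)) +
      (\<Sum>i=1..n. \<Sum>k=1..n. ?D k i)"
    by (subst (2) sum.swap) (simp add: sum.distrib sum_distrib_left distrib_left)
  also have "(\<Sum>k=1..n. ?E (k - 1)) = (\<Sum>k<n. ?E k)"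
    by (rule sum.reindex_bij_witness[of _ Suc "\<lambda>k. k - 1"]) auto
  also have "(\<Sum>k=1..n. ?E (n - k)) = (\<Sum>k<n. ?E k)"
    by (rule sum.reindex_bij_witness[of _ "\<lambda>k. n - k" "\<lambda>k. n - k"]) auto
  also have "(\<Sum>i=1..n. \<Sum>k=1..n. ?D k i) = (\<Sum>i=1..n. real n * (real n - 1) / 2)"
  proof (rule sum.cong[OF refl])
    fix i assume "i \<in> {1..n}"
    hence "i - 1 < n" by auto
    hence "(\<Sum>k=1..n. ?D k i) = fact n * (real n - 1) / 2 * real n / fact n"
      by (simp only: sum_swaps_at_pivot_fixed sum_distrib_right[symmetric]
          sum_divide_distrib[symmetric])
    thus "(\<Sum>k=1..n. ?D k i) = real n * (real n - 1) / 2"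
      by simp
  qed
  finally have "real n * (real n * ?E n) =
      real n * (real n * (real n - 1) / 2 + 2 * (\<Sum>k<n. ?E k))"
    using True by (simp add: field_simps power2_eq_square)
  thus ?thesis using True by (simp only: mult_cancel_left) auto
qed

lemma closed_form_rec:
  defines "a \<equiv> \<lambda>n. (real n + 1) * gen_harmonic 1 n - 2 * real n"
  shows "real n * (real n - 1) / 2 + 2 * (\<Sum>k<n. a k) = real n * a n"
proof (induction n)
  case 0
  show ?case by simp
next
  case (Suc n)
  have "gen_harmonic 1 (Suc n) = gen_harmonic 1 n + 1 / (real n + 1)"
    by (simp add: gen_harmonic_def add.commute)
  hence "real (Suc n) * a (Suc n) = real n * a n + real n + 2 * a n"
    by (simp add: a_def field_simps)
  with Suc.IH show ?case by (simp add: field_simps)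
qed

theorem theorem4p9:
  fixes n :: nat
  assumes "n \<ge> 1"
  shows "measure_pmf.expectation (num_swaps n) real =
           (real n + 1) * gen_harmonic 1 n - 2 * real n"
  using assms
proof (induction n rule: less_induct)
  case (less n)
  have "measure_pmf.expectation (num_swaps k) real = (real k + 1) * gen_harmonic 1 k - 2 * real k"
    if "k < n" for k
    using less.IH[OF that] expectation_num_swaps_0
    by (cases "k = 0") (auto simp: gen_harmonic_def)
  hence "real n * measure_pmf.expectation (num_swaps n) real =
           real n * ((real n + 1) * gen_harmonic 1 n - 2 * real n)"
    by (subst expectation_num_swaps_rec, subst closed_form_rec[symmetric]) simp
  thus ?case using less.prems by simp
qed

end
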